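(* Let $P$ be a simple orthogonal polygon (all edges horizontal or vertical), viewed as a closed track. A human and a puppy are points on the boundary of $P$. The human walks along the boundary at bounded speed and may change direction. Whenever the Euclidean straight-line distance from the puppy to the human can be decreased by moving the puppy along the track in some direction, the puppy runs (with unbounded speed, the human stationary) in such a direction, until it reaches a point of the track where this distance is locally minimal; while the configuration is locally minimal and the human moves, the puppy moves along the track so as to stay at a local minimum until it is forced to run again. The human catches the puppy when their positions coincide. Then, from any initial configuration, the human can catch the puppy by walking counterclockwise around $P$ at most twice. *)

theory Defs
  imports "HOL-Complex_Analysis.Winding_Numbers"
begin

text \<open>The plane is the complex plane. The track (boundary of P) is given by an
  arclength (unit speed) parametrisation \<gamma> :: real \<Rightarrow> complex, periodic with period L
  (the perimeter); positions on the track are lifted to real parameters.\<close>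

definition orth_polygon_track :: "(real \<Rightarrow> complex) \<Rightarrow> real \<Rightarrow> bool" where
  "orth_polygon_track \<gamma> L \<longleftrightarrow>
     L > 0 \<and> (\<forall>t. \<gamma> (t + L) = \<gamma> t) \<and> inj_on \<gamma> {0..<L} \<and>
     (\<exists>(n::nat) (ts::nat \<Rightarrow> real) (ds::nat \<Rightarrow> complex).
        ts 0 = 0 \<and> ts n = L \<and>
        (\<forall>i<n. ts i < ts (Suc i) \<and> ds i \<in> {1, \<i>, -1, -\<i>} \<and>
           (\<forall>t\<in>{ts i..ts (Suc i)}. \<gamma> t = \<gamma> (ts i) + of_real (t - ts i) * ds i)))"

definition ccw_track :: "(real \<Rightarrow> complex) \<Rightarrow> real \<Rightarrow> bool" where
  "ccw_track \<gamma> L \<longleftrightarrow>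
     (\<forall>z \<in> inside (\<gamma> ` {0..L}). winding_number (\<lambda>x. \<gamma> (L * x)) z = 1)"

definition track_locmin :: "(real \<Rightarrow> complex) \<Rightarrow> complex \<Rightarrow> real \<Rightarrow> bool" where
  "track_locmin \<gamma> H u \<longleftrightarrow>
     (\<exists>e>0. \<forall>v. \<bar>v - u\<bar> < e \<longrightarrow> cmod (\<gamma> u - H) \<le> cmod (\<gamma> v - H))"

definition puppy_run :: "(real \<Rightarrow> complex) \<Rightarrow> complex \<Rightarrow> real \<Rightarrow> real \<Rightarrow> bool" where
  "puppy_run \<gamma> H a b \<longleftrightarrow> track_locmin \<gamma> H b \<and>
     ((a < b \<and> (\<forall>u v. a \<le> u \<and> u < v \<and> v \<le> b \<longrightarrow> cmod (\<gamma> v - H) < cmod (\<gamma> u - H))) \<or>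
      (b < a \<and> (\<forall>u v. b \<le> u \<and> u < v \<and> v \<le> a \<longrightarrow> cmod (\<gamma> u - H) < cmod (\<gamma> v - H))))"

text \<open>Admissible puppy trajectory s on the time interval [0,T] when the human walks
  counterclockwise at unit speed starting at parameter h0 (human at \<gamma> (h0 + t) at
  time t), the puppy starting at parameter s0.  s t is the puppy's position after any
  run happening at time t; runs are jumps of s, happening exactly when the puppy's
  position just before (left limit, or s0 at time 0) is not a local minimum.
  Between runs the puppy moves continuously staying at local minima.\<close>
definition puppy_traj ::
  "(real \<Rightarrow> complex) \<Rightarrow> real \<Rightarrow> real \<Rightarrow> real \<Rightarrow> (real \<Rightarrow> real) \<Rightarrow> bool" where
  "puppy_traj \<gamma> h0 s0 T s \<longleftrightarrow>
     (if track_locmin \<gamma> (\<gamma> h0) s0 then s 0 = s0 else puppy_run \<gamma> (\<gamma> h0) s0 (s 0)) \<and>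
     (\<forall>t\<in>{0..T}. track_locmin \<gamma> (\<gamma> (h0 + t)) (s t)) \<and>
     (\<forall>t\<in>{0..<T}. continuous (at_right t) s) \<and>
     (\<forall>t\<in>{0<..T}. \<exists>a. (s \<longlongrightarrow> a) (at_left t) \<and>
        (if track_locmin \<gamma> (\<gamma> (h0 + t)) a then s t = a
         else puppy_run \<gamma> (\<gamma> (h0 + t)) a (s t)))"

end

theory Submission
  imports Defs
begin

text \<open>The puppy gains height only while the human is at least as high as it is. Let \<open>q\<close> be the left end
  of the leftmost topmost edge; counterclockwise orientation makes this edge run to the left, and
  the track enters it from below at its start \<open>e\<close>. Let the human walk to \<open>q\<close>, which takes at most a
  lap. A puppy at rest is then not on the edge. To pass \<open>e\<close> later, the puppy has to climb to top height,
  so the human has to be on some topmost edge, and the puppy then turns left only if the human is to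
  the left of \<open>e\<close>. But all topmost edges visited between \<open>q\<close> and the return to \<open>e\<close> lie to the right.
  Hence the puppy is trapped between the human and \<open>e\<close>, and is caught before the human returns to \<open>e\<close>.\<close>

section \<open>Induction along a real interval and first-order conditions on distances\<close>

text \<open>The infimum of the counterexamples satisfies \<open>P\<close> by \<open>left\<close>,
  and by \<open>right\<close> so does everything just beyond it, so there are none. The two step
  rules fit a trajectory with jumps: left limits exist, and between jumps it is continuous from the
  right.\<close>

lemma real_interval_induct:
  fixes a b :: real
  assumes start: "P a"
    and left: "\<And>x. a < x \<Longrightarrow> x \<le> b \<Longrightarrow> (\<And>y. a \<le> y \<Longrightarrow> y < x \<Longrightarrow> P y) \<Longrightarrow> P x"
    and right: "\<And>x. a \<le> x \<Longrightarrow> x < b \<Longrightarrow> P x \<Longrightarrow> eventually P (at_right x)"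
    and x: "a \<le> x" "x \<le> b"
  shows "P x"
proof (rule ccontr)
  assume nP: "\<not> P x"
  define S where "S = {y. a \<le> y \<and> y \<le> b \<and> \<not> P y}"
  have xS: "x \<in> S" using nP x by (simp add: S_def)
  have bdd: "bdd_below S" by (auto simp: S_def intro: bdd_belowI[of _ a])
  define c where "c = Inf S"
  have ac: "a \<le> c" unfolding c_def using xS by (intro cInf_greatest) (auto simp: S_def)
  have cb: "c \<le> b" unfolding c_def using cInf_lower[OF xS bdd] x by linarith
  have below: "P y" if "a \<le> y" "y < c" for y
    using that cInf_lower[OF _ bdd, of y] cb unfolding c_def[symmetric] by (fastforce simp: S_def)
  have Pc: "P c"
    using start left[of c] below ac cb by (cases "a = c") auto
  have "c < b"
  proof (rule ccontr)
    assume "\<not> c < b"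
    moreover have "c \<le> x" using cInf_lower[OF xS bdd] by (simp add: c_def)
    ultimately have "x = c" using x cb by linarith
    with nP Pc show False by simp
  qed
  from right[OF ac this Pc] obtain d where "d > c" and d: "\<And>y. c < y \<Longrightarrow> y < d \<Longrightarrow> P y"
    unfolding eventually_at_right_field by auto
  then obtain y where "y \<in> S" "y < d"
    using cInf_lessD[of S d] xS unfolding c_def by auto
  moreover have "c \<le> y" using cInf_lower[OF \<open>y \<in> S\<close> bdd] by (simp add: c_def)
  ultimately show False using d[of y] Pc by (cases "c = y") (auto simp: S_def)
qed

text \<open>Expanding the squared norms and dividing by \<open>w > 0\<close> leaves
  \<open>0 \<le> 2 * (x \<bullet> d) + w * (d \<bullet> d)\<close>; then let \<open>w\<close> tend
  to 0.\<close>

lemma inner_nonneg_if_norm_le: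
  fixes x d :: "'a::real_inner"
  assumes "\<epsilon> > 0" and le: "\<And>w. 0 < w \<Longrightarrow> w < \<epsilon> \<Longrightarrow> norm x \<le> norm (x + w *\<^sub>R d)"
  shows "0 \<le> x \<bullet> d"
proof -
  have pos: "0 \<le> 2 * (x \<bullet> d) + w * (d \<bullet> d)" if w: "0 < w" "w < \<epsilon>" for w
  proof -
    have "x \<bullet> x \<le> (x + w *\<^sub>R d) \<bullet> (x + w *\<^sub>R d)"
      using le[OF w] by (simp add: norm_le)
    then have "0 \<le> w * (2 * (x \<bullet> d) + w * (d \<bullet> d))"
      by (simp add: algebra_simps inner_commute)
    then show ?thesis using w by (simp add: zero_le_mult_iff)
  qed
  have "((\<lambda>w. 2 * (x \<bullet> d) + w * (d \<bullet> d)) \<longlongrightarrow> 2 * (x \<bullet> d) + 0 * (d \<bullet> d)) (at_right 0)"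
    by (intro tendsto_intros)
  moreover have "eventually (\<lambda>w. 0 \<le> 2 * (x \<bullet> d) + w * (d \<bullet> d)) (at_right 0)"
    unfolding eventually_at_right_field using pos assms(1) by blast
  ultimately have "0 \<le> 2 * (x \<bullet> d) + 0 * (d \<bullet> d)"
    by (rule tendsto_lowerbound) simp
  then show ?thesis by simp
qed

text \<open>Here \<open>w\<close> need not be small: the quadratic term is nonnegative, so only the
  linear term can make the distance shrink.\<close>

lemma inner_neg_if_norm_less:
  fixes x d :: "'a::real_inner"
  assumes "w > 0" "norm (x + w *\<^sub>R d) < norm x"
  shows "x \<bullet> d < 0"
proof -
  have "(x + w *\<^sub>R d) \<bullet> (x + w *\<^sub>R d) < x \<bullet> x"
    using assms(2) by (simp add: norm_lt)
  then have "w * (2 * (x \<bullet> d) + w * (d \<bullet> d)) < 0"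
    by (simp add: algebra_simps inner_commute)
  then have "2 * (x \<bullet> d) + w * (d \<bullet> d) < 0"
    using assms(1) by (simp add: mult_less_0_iff)
  moreover have "0 \<le> w * (d \<bullet> d)" using assms(1) by simp
  ultimately show ?thesis by linarith
qed

section \<open>Periodicity, straight pieces and injectivity of the track\<close>

text \<open>The list of edges is replaced by the outgoing and the incoming direction at each
  parameter. Both are directions of travel, so they agree inside an edge and may differ only at a
  corner.\<close>

locale orth_track =
  fixes \<gamma> :: "real \<Rightarrow> complex" and L :: real
  assumes L_pos: "L > 0"
    and periodic: "\<And>t. \<gamma> (t + L) = \<gamma> t"
    and inj: "inj_on \<gamma> {0..<L}"
    and forward: "\<And>t. \<exists>d\<in>{1, \<i>, -1, -\<i>}. \<exists>\<epsilon>>0. \<forall>u\<in>{0..\<epsilon>}. \<gamma> (t + u) = \<gamma> t + u *\<^sub>R d"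
    and backward: "\<And>t. \<exists>d\<in>{1, \<i>, -1, -\<i>}. \<exists>\<epsilon>>0. \<forall>u\<in>{0..\<epsilon>}. \<gamma> (t - u) = \<gamma> t - u *\<^sub>R d"

lemma periodic_of_int:
  fixes f :: "real \<Rightarrow> 'a"
  assumes "\<And>t. f (t + p) = f t"
  shows "f (t + of_int m * p) = f t"
proof (induction m arbitrary: t rule: int_induct[where k = 0])
  case (step1 i)
  then show ?case using assms[of "t + of_int i * p"] by (simp add: algebra_simps)
next
  case (step2 i)
  then show ?case using assms[of "t + of_int (i - 1) * p"] by (simp add: algebra_simps)
qed simp

lemma periodic_reduce:
  fixes p t :: real
  assumes "p > 0"
  obtains m :: int where "0 \<le> t - of_int m * p" "t - of_int m * p < p"
proof
  show "0 \<le> t - of_int \<lfloor>t / p\<rfloor> * p"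
    using assms by (simp add: floor_divide_lower)
  show "t - of_int \<lfloor>t / p\<rfloor> * p < p"
    using floor_divide_upper[OF assms, of t] by (simp add: algebra_simps)
qed

text \<open>Half-open on the right, so that a breakpoint is assigned to its outgoing edge; the
  mirror version below assigns it to its incoming edge.\<close>

lemma partition_interval_right:
  fixes ts :: "nat \<Rightarrow> real"
  assumes "ts 0 \<le> t" "t < ts n"
  shows "\<exists>i<n. ts i \<le> t \<and> t < ts (Suc i)"
  using assms
proof (induction n)
  case (Suc n)
  show ?case
  proof (cases "t < ts n")
    case True
    with Suc obtain i where "i < n" "ts i \<le> t \<and> t < ts (Suc i)" by blast
    then show ?thesis by (auto intro!: exI[of _ i])
  next
    case False
    with Suc show ?thesis by (auto intro!: exI[of _ n])
  qed
qed simp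

lemma partition_interval_left:
  fixes ts :: "nat \<Rightarrow> real"
  assumes "ts 0 < t" "t \<le> ts n"
  shows "\<exists>i<n. ts i < t \<and> t \<le> ts (Suc i)"
  using assms
proof (induction n)
  case (Suc n)
  show ?case
  proof (cases "t \<le> ts n")
    case True
    with Suc obtain i where "i < n" "ts i < t \<and> t \<le> ts (Suc i)" by blast
    then show ?thesis by (auto intro!: exI[of _ i])
  next
    case False
    with Suc show ?thesis by (auto intro!: exI[of _ n])
  qed
qed simp

lemma orth_track_if_orth_polygon_track:
  assumes "orth_polygon_track \<gamma> L"
  shows "orth_track \<gamma> L"
proof -
  from assms obtain n ts ds where L: "L > 0" and per: "\<And>t. \<gamma> (t + L) = \<gamma> t"
    and inj: "inj_on \<gamma> {0..<L}" and ts: "ts (0::nat) = 0" "ts n = L"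
    and edge: "\<And>i. i < n \<Longrightarrow> ts i < ts (Suc i)" "\<And>i. i < n \<Longrightarrow> ds i \<in> {1, \<i>, -1, -\<i>}"
      "\<And>i t. i < n \<Longrightarrow> t \<in> {ts i..ts (Suc i)} \<Longrightarrow> \<gamma> t = \<gamma> (ts i) + of_real (t - ts i) * ds i"
    unfolding orth_polygon_track_def by blast
  note per' = periodic_of_int[of \<gamma> L, OF per]
  show ?thesis
  proof
    fix t
    obtain m :: int where m: "0 \<le> t - of_int m * L" "t - of_int m * L < L"
      using periodic_reduce[OF L] by blast
    define t' where "t' = t - of_int m * L"
    obtain i where i: "i < n" "ts i \<le> t'" "t' < ts (Suc i)"
      using partition_interval_right[of ts t' n] m ts by (auto simp: t'_def)
    have "\<gamma> (t + u) = \<gamma> t + u *\<^sub>R ds i" if "u \<in> {0..ts (Suc i) - t'}" for u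
    proof -
      have eq1: "\<gamma> (t + u) = \<gamma> (t' + u)" "\<gamma> t = \<gamma> t'"
        using per'[of "t' + u" m] per'[of t' m] by (auto simp: t'_def algebra_simps)
      have eq2: "\<gamma> (t' + u) = \<gamma> (ts i) + of_real (t' + u - ts i) * ds i"
        "\<gamma> t' = \<gamma> (ts i) + of_real (t' - ts i) * ds i"
        using that i by (intro edge(3); simp)+
      show ?thesis unfolding eq1 eq2 by (simp add: scaleR_conv_of_real algebra_simps)
    qed
    then show "\<exists>d\<in>{1, \<i>, -1, -\<i>}. \<exists>\<epsilon>>0. \<forall>u\<in>{0..\<epsilon>}. \<gamma> (t + u) = \<gamma> t + u *\<^sub>R d"
      using edge(2)[OF i(1)] i(3) by (intro bexI[of _ "ds i"] exI[of _ "ts (Suc i) - t'"]) auto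
  next
    fix t
    obtain m :: int where m: "0 \<le> - t - of_int m * L" "- t - of_int m * L < L"
      using periodic_reduce[OF L] by blast
    \<comment> \<open>An incoming edge needs a representative in \<open>(0, L]\<close> instead of
      \<open>[0, L)\<close>, so \<open>-t\<close> is reduced modulo \<open>L\<close> and
      reflected.\<close>
    define t' where "t' = L + (t + of_int m * L)"
    obtain i where i: "i < n" "ts i < t'" "t' \<le> ts (Suc i)"
      using partition_interval_left[of ts t' n] m ts by (auto simp: t'_def)
    have "\<gamma> (t - u) = \<gamma> t - u *\<^sub>R ds i" if "u \<in> {0..t' - ts i}" for u
    proof -
      have eq1: "\<gamma> (t - u) = \<gamma> (t' - u)" "\<gamma> t = \<gamma> t'"
        using per'[of "t - u" "m + 1"] per'[of t "m + 1"] by (auto simp: t'_def algebra_simps)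
      have eq2: "\<gamma> (t' - u) = \<gamma> (ts i) + of_real (t' - u - ts i) * ds i"
        "\<gamma> t' = \<gamma> (ts i) + of_real (t' - ts i) * ds i"
        using that i by (intro edge(3); simp)+
      show ?thesis unfolding eq1 eq2 by (simp add: scaleR_conv_of_real algebra_simps)
    qed
    then show "\<exists>d\<in>{1, \<i>, -1, -\<i>}. \<exists>\<epsilon>>0. \<forall>u\<in>{0..\<epsilon>}. \<gamma> (t - u) = \<gamma> t - u *\<^sub>R d"
      using edge(2)[OF i(1)] i(2) by (intro bexI[of _ "ds i"] exI[of _ "t' - ts i"]) auto
  qed (use L per inj in auto)
qed

context orth_track
begin

lemmas periodic_int = periodic_of_int[of \<gamma> L, OF periodic]

text \<open>Reducing both parameters to \<open>[0, L)\<close> shows that they differ by an integer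
  multiple of \<open>L\<close>; being less than \<open>L\<close> apart, they coincide. This gives
  injectivity on every window shorter than a lap.\<close>

lemma inj_mod_period:
  assumes eq: "\<gamma> a = \<gamma> b" and "\<bar>a - b\<bar> < L"
  shows "a = b"
proof -
  obtain m :: int where m: "0 \<le> a - of_int m * L" "a - of_int m * L < L"
    using periodic_reduce[OF L_pos] by blast
  obtain k :: int where k: "0 \<le> b - of_int k * L" "b - of_int k * L < L"
    using periodic_reduce[OF L_pos] by blast
  have "\<gamma> (a - of_int m * L) = \<gamma> (b - of_int k * L)"
    using eq periodic_int[of "a - of_int m * L" m] periodic_int[of "b - of_int k * L" k] by simp
  then have "a - of_int m * L = b - of_int k * L"
    using m k by (intro inj_onD[OF inj]) auto
  then have ab: "a - b = of_int (m - k) * L" by (simp add: algebra_simps)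
  then have "\<bar>of_int (m - k)\<bar> * L < 1 * L"
    using assms(2) L_pos by (simp add: abs_mult)
  then have "\<bar>real_of_int (m - k)\<bar> < 1"
    using L_pos by (simp only: mult_less_cancel_right_pos)
  then have "m = k" by linarith
  with ab show ?thesis by simp
qed

lemma continuous_track: "continuous (at t) \<gamma>"
proof -
  obtain d \<epsilon> where e: "\<epsilon> > 0" "\<And>u. u \<in> {0..\<epsilon>} \<Longrightarrow> \<gamma> (t + u) = \<gamma> t + u *\<^sub>R d"
    using forward[of t] by blast
  obtain d' \<epsilon>' where e': "\<epsilon>' > 0" "\<And>u. u \<in> {0..\<epsilon>'} \<Longrightarrow> \<gamma> (t - u) = \<gamma> t - u *\<^sub>R d'"
    using backward[of t] by blast
  have "((\<lambda>x. \<gamma> t + (x - t) *\<^sub>R d) \<longlongrightarrow> \<gamma> t + (t - t) *\<^sub>R d) (at_right t)"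
    by (intro tendsto_intros)
  moreover have "eventually (\<lambda>x. \<gamma> t + (x - t) *\<^sub>R d = \<gamma> x) (at_right t)"
    unfolding eventually_at_right_field
  proof (intro exI conjI allI impI)
    show "t < t + \<epsilon>" using e(1) by simp
    show "\<gamma> t + (x - t) *\<^sub>R d = \<gamma> x" if "t < x" "x < t + \<epsilon>" for x
      using e(2)[of "x - t"] that by simp
  qed
  ultimately have r: "(\<gamma> \<longlongrightarrow> \<gamma> t) (at_right t)"
    using Lim_transform_eventually by fastforce
  have "((\<lambda>x. \<gamma> t - (t - x) *\<^sub>R d') \<longlongrightarrow> \<gamma> t - (t - t) *\<^sub>R d') (at_left t)"
    by (intro tendsto_intros)
  moreover have "eventually (\<lambda>x. \<gamma> t - (t - x) *\<^sub>R d' = \<gamma> x) (at_left t)"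
    unfolding eventually_at_left_field
  proof (intro exI conjI allI impI)
    show "t - \<epsilon>' < t" using e'(1) by simp
    show "\<gamma> t - (t - x) *\<^sub>R d' = \<gamma> x" if "t - \<epsilon>' < x" "x < t" for x
      using e'(2)[of "t - x"] that by simp
  qed
  ultimately have l: "(\<gamma> \<longlongrightarrow> \<gamma> t) (at_left t)"
    using Lim_transform_eventually by fastforce
  show ?thesis
    using r l by (simp add: continuous_within filterlim_split_at)
qed

lemma continuous_on_track: "continuous_on S \<gamma>"
  using continuous_track continuous_at_imp_continuous_on by blast

section \<open>Resting positions on straight pieces\<close>

text \<open>The inner product is half the derivative of the squared distance to \<open>H\<close>
  along the outgoing edge. The next lemma treats the incoming edge, which is traversed against
  \<open>d\<close>, hence the reversed sign.\<close>

lemma locmin_forward: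
  assumes "track_locmin \<gamma> H x" "\<epsilon> > 0" "\<And>u. u \<in> {0..\<epsilon>} \<Longrightarrow> \<gamma> (x + u) = \<gamma> x + u *\<^sub>R d"
  shows "0 \<le> (\<gamma> x - H) \<bullet> d"
proof -
  obtain r where r: "r > 0" "\<And>v. \<bar>v - x\<bar> < r \<Longrightarrow> cmod (\<gamma> x - H) \<le> cmod (\<gamma> v - H)"
    using assms(1) unfolding track_locmin_def by blast
  show ?thesis
  proof (rule inner_nonneg_if_norm_le[where \<epsilon> = "min r \<epsilon>"])
    fix w assume w: "0 < w" "w < min r \<epsilon>"
    then show "norm (\<gamma> x - H) \<le> norm (\<gamma> x - H + w *\<^sub>R d)"
      using r(2)[of "x + w"] assms(3)[of w] by (simp add: algebra_simps)
  qed (use r assms in auto)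
qed

lemma locmin_backward:
  assumes "track_locmin \<gamma> H x" "\<epsilon> > 0" "\<And>u. u \<in> {0..\<epsilon>} \<Longrightarrow> \<gamma> (x - u) = \<gamma> x - u *\<^sub>R d"
  shows "(\<gamma> x - H) \<bullet> d \<le> 0"
proof -
  obtain r where r: "r > 0" "\<And>v. \<bar>v - x\<bar> < r \<Longrightarrow> cmod (\<gamma> x - H) \<le> cmod (\<gamma> v - H)"
    using assms(1) unfolding track_locmin_def by blast
  have "0 \<le> (\<gamma> x - H) \<bullet> (- d)"
  proof (rule inner_nonneg_if_norm_le[where \<epsilon> = "min r \<epsilon>"])
    fix w assume w: "0 < w" "w < min r \<epsilon>"
    then show "norm (\<gamma> x - H) \<le> norm (\<gamma> x - H + w *\<^sub>R (- d))"
      using r(2)[of "x - w"] assms(3)[of w] by (simp add: algebra_simps)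
  qed (use r assms in auto)
  then show ?thesis by simp
qed

section \<open>Orientation of a topmost edge\<close>

text \<open>Crossing a rightward edge from above to below lowers the winding number; above a topmost edge
  it is 0, so it cannot be 1 at the inside points just below.\<close>
lemma ccw_no_rightward_top_edge:
  assumes ccw: "ccw_track \<gamma> L" and top: "\<And>t. Im (\<gamma> t) \<le> Im (\<gamma> q)"
    and "\<epsilon> > 0" and edge: "\<And>u. u \<in> {0..\<epsilon>} \<Longrightarrow> \<gamma> (q + u) = \<gamma> q + u *\<^sub>R 1"
  shows False
proof -
  obtain m :: int where m: "0 \<le> q - of_int m * L" "q - of_int m * L < L"
    using periodic_reduce[OF L_pos] by blast
  define q' where "q' = q - of_int m * L"
  \<comment> \<open>The piece of length \<open>2 * \<delta>\<close> starting at \<open>q'\<close>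
    stays on the edge and within the lap \<open>[0, L]\<close>, so the loop splits into an initial
    part, a straight segment centred at \<open>c\<close>, and a final part.\<close>
  define \<delta> where "\<delta> = min \<epsilon> (L - q') / 2"
  define c where "c = q' + \<delta>"
  define y where "y = Im (\<gamma> q)"
  have \<delta>: "\<delta> > 0" "2 * \<delta> \<le> \<epsilon>" "2 * \<delta> \<le> L - q'"
    using m \<open>\<epsilon> > 0\<close> by (auto simp: \<delta>_def q'_def)
  have c: "0 \<le> c - \<delta>" "c + \<delta> \<le> L" using \<delta> m by (auto simp: c_def q'_def)
  have edge0: "\<gamma> (q' + u) = \<gamma> q + of_real u" if "0 \<le> u" "u \<le> 2 * \<delta>" for u
    using edge[of u] that \<delta> periodic_int[of "q' + u" m]
    by (simp add: q'_def algebra_simps scaleR_conv_of_real)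
  have edge': "\<gamma> (c + u) = \<gamma> c + of_real u" if "-\<delta> \<le> u" "u \<le> \<delta>" for u
    using edge0[of "\<delta> + u"] edge0[of \<delta>] that \<delta> by (simp add: c_def algebra_simps)
  have Imc: "Im (\<gamma> c) = y" using edge0[of \<delta>] \<delta> by (simp add: c_def y_def)
  define p where "p = (\<lambda>x. \<gamma> (L * x))"
  have path: "path p"
    unfolding p_def path_def
    by (rule continuous_on_compose2[OF continuous_on_track[of UNIV]]) (auto intro: continuous_on_mult_left)
  have closed: "pathfinish p = pathstart p"
    using periodic[of 0] by (simp add: p_def pathfinish_def pathstart_def)
  have "L * u = L * v" if "u \<in> {0..1}" "v \<in> {0..1}" "p u = p v" "\<bar>u - v\<bar> < 1" for u v
  proof (rule inj_mod_period)
    show "\<gamma> (L * u) = \<gamma> (L * v)" using that by (simp add: p_def)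
    have "\<bar>L * u - L * v\<bar> = L * \<bar>u - v\<bar>"
      using L_pos by (simp add: abs_mult flip: right_diff_distrib)
    also have "\<dots> < L * 1" using that(4) L_pos by (intro mult_strict_left_mono) auto
    finally show "\<bar>L * u - L * v\<bar> < L" by simp
  qed
  then have p_inj: "u = v" if "u \<in> {0..1}" "v \<in> {0..1}" "p u = p v" "\<bar>u - v\<bar> < 1" for u v
    using that L_pos by fastforce
  have "loop_free p"
    unfolding loop_free_def
  proof (intro ballI impI)
    fix u v :: real
    assume uv: "u \<in> {0..1}" "v \<in> {0..1}" "p u = p v"
    show "u = v \<or> u = 0 \<and> v = 1 \<or> u = 1 \<and> v = 0"
      using p_inj[OF uv] uv(1,2) by (cases "\<bar>u - v\<bar> < 1") auto
  qed
  with path have simple: "simple_path p" by (simp add: simple_path_def)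
  have image: "path_image p = \<gamma> ` {0..L}"
  proof -
    have "(\<lambda>x. L * x) ` {0..1} = {0..L}"
      using L_pos by (simp add: image_mult_atLeastAtMost)
    then show ?thesis unfolding path_image_def p_def by (metis image_image)
  qed
  define \<alpha> \<beta> where "\<alpha> = (c - \<delta>) / L" and "\<beta> = (c + \<delta>) / L"
  have \<alpha>\<beta>: "\<alpha> \<in> {0..1}" "\<beta> \<in> {0..1}" "\<alpha> < c / L" "c / L < \<beta>" "L * \<alpha> = c - \<delta>" "L * \<beta> = c + \<delta>"
    using c \<delta> L_pos by (auto simp: \<alpha>_def \<beta>_def divide_simps)
  have pc: "p (c / L) = \<gamma> c" using L_pos by (simp add: p_def)
  define a b where "a = \<gamma> (c - \<delta>)" and "b = \<gamma> (c + \<delta>)"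
  have ab: "a = \<gamma> c - of_real \<delta>" "b = \<gamma> c + of_real \<delta>"
    using edge'[of "-\<delta>"] edge'[of \<delta>] \<delta> by (simp_all add: a_def b_def)
  define g1 g2 where "g1 = subpath 0 \<alpha> p" and "g2 = subpath \<beta> 1 p"
  have g: "path g1" "path g2" using path \<alpha>\<beta> by (auto simp: g1_def g2_def)
  have n1: "\<gamma> c \<notin> path_image g1"
  proof
    assume "\<gamma> c \<in> path_image g1"
    then obtain u where u: "0 \<le> u" "u \<le> \<alpha>" "p u = p (c / L)"
      using \<alpha>\<beta> by (auto simp: g1_def path_image_subpath pc)
    then have "u = c / L" using \<alpha>\<beta> by (intro p_inj) auto
    then show False using u \<alpha>\<beta> by simp
  qed
  have n2: "\<gamma> c \<notin> path_image g2"
  proof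
    assume "\<gamma> c \<in> path_image g2"
    then obtain u where u: "u \<le> 1" "\<beta> \<le> u" "p u = p (c / L)"
      using \<alpha>\<beta> by (auto simp: g2_def path_image_subpath pc)
    then have "u = c / L" using \<alpha>\<beta> by (intro p_inj) auto
    then show False using u \<alpha>\<beta> by simp
  qed
  \<comment> \<open>Since \<open>\<gamma> c\<close> lies on neither remaining part of the loop,
    their winding numbers are continuous there.\<close>
  obtain r1 where r1: "r1 > 0"
    "\<And>z. dist z (\<gamma> c) < r1 \<Longrightarrow> dist (winding_number g1 z) (winding_number g1 (\<gamma> c)) < 1/8"
    using continuous_at_winding_number[OF g(1) n1]
    unfolding continuous_at_eps_delta by (metis zero_less_divide_1_iff zero_less_numeral)
  obtain r2 where r2: "r2 > 0"
    "\<And>z. dist z (\<gamma> c) < r2 \<Longrightarrow> dist (winding_number g2 z) (winding_number g2 (\<gamma> c)) < 1/8"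
    using continuous_at_winding_number[OF g(2) n2]
    unfolding continuous_at_eps_delta by (metis zero_less_divide_1_iff zero_less_numeral)
  define r where "r = min \<delta> (min r1 r2)"
  have r: "r > 0" "r \<le> \<delta>" "r \<le> r1" "r \<le> r2" using r1 r2 \<delta> by (auto simp: r_def)
  have "\<gamma> c \<in> path_image p" using c \<delta> by (auto simp: image)
  \<comment> \<open>By the Jordan curve theorem each track point is a limit of inside points, so
    some inside point \<open>\<zeta>\<close> is as near to \<open>\<gamma> c\<close> as
    desired.\<close>
  then have "\<gamma> c \<in> frontier (inside (path_image p))"
    using Jordan_inside_outside[OF simple closed] by simp
  then obtain \<zeta> where \<zeta>: "\<zeta> \<in> inside (path_image p)" "dist (\<gamma> c) \<zeta> < r"
    using r by (auto simp: frontier_straddle)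
  have \<zeta>n: "\<zeta> \<notin> path_image p" using \<zeta> inside_no_overlap by blast
  have w1: "winding_number p \<zeta> = 1"
    using ccw \<zeta>(1)[unfolded image] unfolding ccw_track_def p_def by blast
  have w0: "winding_number p z = 0" if "Im z > y" for z
  proof (rule winding_number_zero_outside[OF path _ closed])
    show "convex {z. Im z \<le> y}" by (rule convex_halfspace_Im_le)
    show "path_image p \<subseteq> {z. Im z \<le> y}" using top by (auto simp: image y_def)
  qed (use that in auto)
  have "Im \<zeta> \<le> y" using w0[of \<zeta>] w1 by (cases "Im \<zeta> > y") auto
  \<comment> \<open>At height \<open>y\<close> and this close to \<open>\<gamma> c\<close>, the
    point would lie on the edge itself.\<close>
  moreover have "Im \<zeta> \<noteq> y"
  proof
    assume "Im \<zeta> = y"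
    moreover have "\<bar>Re \<zeta> - Re (\<gamma> c)\<bar> < \<delta>"
      using abs_Re_le_cmod[of "\<zeta> - \<gamma> c"] \<zeta>(2) r by (simp add: dist_norm norm_minus_commute)
    ultimately have "\<zeta> = \<gamma> (c + (Re \<zeta> - Re (\<gamma> c)))"
      by (subst edge') (auto simp: complex_eq_iff Imc)
    moreover have "c + (Re \<zeta> - Re (\<gamma> c)) \<in> {0..L}"
      using \<open>\<bar>Re \<zeta> - Re (\<gamma> c)\<bar> < \<delta>\<close> c by (simp add: abs_less_iff)
    ultimately show False using \<zeta>n by (auto simp: image)
  qed
  ultimately have Im\<zeta>: "Im \<zeta> < y" by simp
  \<comment> \<open>The mirror image of \<open>\<zeta>\<close> in the line of the edge: it is
    equally close to \<open>\<gamma> c\<close> but above the whole track, where the winding number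
    is 0.\<close>
  define \<zeta>' where "\<zeta>' = Complex (Re \<zeta>) (2 * y - Im \<zeta>)"
  have Im\<zeta>': "Im \<zeta>' > y" using Im\<zeta> by (simp add: \<zeta>'_def)
  have \<zeta>'n: "\<zeta>' \<notin> path_image p" using Im\<zeta>' top by (auto simp: image y_def not_less[symmetric])
  have d': "dist \<zeta>' (\<gamma> c) < r"
  proof -
    have "cmod (\<zeta>' - \<gamma> c) = cmod (\<zeta> - \<gamma> c)"
      unfolding cmod_def \<zeta>'_def using Imc by (simp add: power2_eq_square algebra_simps)
    then show ?thesis using \<zeta>(2) by (simp add: dist_norm norm_minus_commute)
  qed
  have line: "winding_number (subpath \<alpha> \<beta> p) z = winding_number (linepath a b) z" for z
  proof (rule winding_number_cong)
    fix t :: real assume t: "0 \<le> t" "t \<le> 1"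
    have "L * ((\<beta> - \<alpha>) * t + \<alpha>) = (L * \<beta> - L * \<alpha>) * t + L * \<alpha>" by (simp add: algebra_simps)
    also have "\<dots> = c + (2 * t - 1) * \<delta>" unfolding \<alpha>\<beta>(5,6) by (simp add: algebra_simps)
    finally have "subpath \<alpha> \<beta> p t = \<gamma> (c + (2 * t - 1) * \<delta>)" by (simp add: subpath_def p_def)
    also have "\<dots> = \<gamma> c + of_real ((2 * t - 1) * \<delta>)"
    proof (rule edge')
      have "- 1 * \<delta> \<le> (2 * t - 1) * \<delta>" using t \<delta> by (intro mult_right_mono) auto
      then show "- \<delta> \<le> (2 * t - 1) * \<delta>" by simp
      have "(2 * t - 1) * \<delta> \<le> 1 * \<delta>" using t \<delta> by (intro mult_right_mono) auto
      then show "(2 * t - 1) * \<delta> \<le> \<delta>" by simp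
    qed
    also have "\<dots> = linepath a b t"
      by (simp add: linepath_def ab scaleR_conv_of_real algebra_simps)
    finally show "subpath \<alpha> \<beta> p t = linepath a b t" .
  qed
  have split: "winding_number p z =
      winding_number g1 z + winding_number (linepath a b) z + winding_number g2 z"
    if "z \<notin> path_image p" for z
    using winding_number_subpath_combine[OF path that, of 0 \<alpha> \<beta>]
      winding_number_subpath_combine[OF path that, of 0 \<beta> 1] \<alpha>\<beta>
    by (simp add: g1_def g2_def line)
  \<comment> \<open>A segment running to the right turns counterclockwise around a point above it
    and clockwise around a point below it.\<close>
  have up: "0 < Re (winding_number (linepath a b) \<zeta>')"
    using Im\<zeta>' \<delta> by (intro winding_number_linepath_pos_lt) (simp add: ab Imc)
  have "0 < Re (winding_number (linepath b a) \<zeta>)"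
    using Im\<zeta> \<delta> by (intro winding_number_linepath_pos_lt) (simp add: ab Imc mult_pos_neg)
  moreover have "\<zeta> \<notin> closed_segment a b"
  proof
    assume "\<zeta> \<in> closed_segment a b"
    then obtain u where "\<zeta> = (1 - u) *\<^sub>R a + u *\<^sub>R b" by (auto simp: closed_segment_def)
    then have "Im \<zeta> = y" unfolding ab by (simp add: Imc left_diff_distrib)
    with Im\<zeta> show False by simp
  qed
  ultimately have down: "Re (winding_number (linepath a b) \<zeta>) < 0"
    using winding_number_reversepath[of "linepath a b" \<zeta>] by simp
  have close: "Re (winding_number g' z) < Re (winding_number g' (\<gamma> c)) + 1/8"
    "Re (winding_number g' (\<gamma> c)) < Re (winding_number g' z) + 1/8"
    if "dist z (\<gamma> c) < r" "g' \<in> {g1, g2}" for z g'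
  proof -
    have "cmod (winding_number g' z - winding_number g' (\<gamma> c)) < 1/8"
      using r1(2)[of z] r2(2)[of z] r that by (auto simp: dist_norm)
    then have "\<bar>Re (winding_number g' z) - Re (winding_number g' (\<gamma> c))\<bar> < 1/8"
      using abs_Re_le_cmod[of "winding_number g' z - winding_number g' (\<gamma> c)"] by simp
    then show "Re (winding_number g' z) < Re (winding_number g' (\<gamma> c)) + 1/8"
      "Re (winding_number g' (\<gamma> c)) < Re (winding_number g' z) + 1/8" by linarith+
  qed
  have d: "dist \<zeta> (\<gamma> c) < r" using \<zeta> by (simp add: dist_commute)
  \<comment> \<open>The parts \<open>g1\<close> and \<open>g2\<close> together contribute more than
    1 at \<open>\<zeta>\<close> and less than 0 at \<open>\<zeta>'\<close>. Yet both sums are within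
    1/4 of their value at \<open>\<gamma> c\<close>, so they differ by less than 1/2.\<close>
  have "Re (winding_number g1 \<zeta>) + Re (winding_number (linepath a b) \<zeta>) + Re (winding_number g2 \<zeta>) = 1"
    "Re (winding_number g1 \<zeta>') + Re (winding_number (linepath a b) \<zeta>') + Re (winding_number g2 \<zeta>') = 0"
    using arg_cong[OF split[OF \<zeta>n], of Re] arg_cong[OF split[OF \<zeta>'n], of Re] w1 w0[OF Im\<zeta>'] by auto
  with close(1)[OF d, of g1] close(1)[OF d, of g2] close(2)[OF d', of g1] close(2)[OF d', of g2] up down
  show False by simp
qed

section \<open>The leftmost topmost edge\<close>

definition top_left :: "real \<Rightarrow> bool" where
  "top_left q \<longleftrightarrow> (\<forall>t. Im (\<gamma> t) \<le> Im (\<gamma> q) \<and> (Im (\<gamma> t) = Im (\<gamma> q) \<longrightarrow> Re (\<gamma> q) \<le> Re (\<gamma> t)))"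

text \<open>Compactness is used twice: for the greatest height over one lap, then for the least
  abscissa on the closed set of maximisers. The window starts anywhere, so the human reaches such a
  point within a lap.\<close>

lemma ex_top_left: "\<exists>q\<in>{a..a + L}. top_left q"
proof -
  let ?I = "{a..a + L}"
  have "continuous_on ?I (\<lambda>t. Im (\<gamma> t))"
    by (intro continuous_intros continuous_on_track)
  then obtain q1 where q1: "q1 \<in> ?I" "\<And>t. t \<in> ?I \<Longrightarrow> Im (\<gamma> t) \<le> Im (\<gamma> q1)"
    using continuous_attains_sup[of ?I "\<lambda>t. Im (\<gamma> t)"] L_pos by auto
  define K where "K = {t \<in> ?I. Im (\<gamma> t) = Im (\<gamma> q1)}"
  have "closed K"
    unfolding K_def
    by (intro continuous_closed_preimage_constant continuous_intros continuous_on_track)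
  moreover have "bounded K" unfolding K_def by (rule bounded_subset[of ?I]) auto
  ultimately have "compact K" by (simp add: compact_eq_bounded_closed)
  moreover have "K \<noteq> {}" using q1 by (auto simp: K_def)
  moreover have "continuous_on K (\<lambda>t. Re (\<gamma> t))"
    by (intro continuous_intros continuous_on_track)
  ultimately obtain q where q: "q \<in> K" "\<And>t. t \<in> K \<Longrightarrow> Re (\<gamma> q) \<le> Re (\<gamma> t)"
    using continuous_attains_inf[of K "\<lambda>t. Re (\<gamma> t)"] by auto
  have "\<exists>t'\<in>?I. \<gamma> t = \<gamma> t'" for t
  proof -
    obtain m :: int where m: "0 \<le> (t - a) - of_int m * L" "(t - a) - of_int m * L < L"
      using periodic_reduce[OF L_pos] by blast
    then show ?thesis
      using periodic_int[of "t - of_int m * L" m] by (intro bexI[of _ "t - of_int m * L"]) auto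
  qed
  then show ?thesis
    using q q1 unfolding top_left_def K_def by (metis (mono_tags, lifting) mem_Collect_eq)
qed

text \<open>Extremality and orientation force the track to leave \<open>q\<close> downwards, and
  then to arrive there leftwards. The edge is followed back to its start \<open>e\<close>, where
  extending it, retracing it and arriving from above are all impossible.\<close>

lemma top_left_edge:
  assumes "ccw_track \<gamma> L" and tl: "top_left q"
  obtains e \<epsilon> where "q - L < e" "e < q" "\<And>w. w \<in> {e..q} \<Longrightarrow> \<gamma> w = \<gamma> q + of_real (q - w)"
    "\<epsilon> > 0" "\<And>u. u \<in> {0..\<epsilon>} \<Longrightarrow> \<gamma> (e - u) = \<gamma> e - u *\<^sub>R \<i>"
proof -
  have top: "Im (\<gamma> t) \<le> Im (\<gamma> q)" for t using tl by (auto simp: top_left_def)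
  have left: "Re (\<gamma> q) \<le> Re (\<gamma> t)" if "Im (\<gamma> t) = Im (\<gamma> q)" for t
    using tl that by (auto simp: top_left_def)
  obtain d1 \<epsilon>1 where d1: "d1 \<in> {1, \<i>, -1, -\<i>}" "\<epsilon>1 > 0"
    "\<And>u. u \<in> {0..\<epsilon>1} \<Longrightarrow> \<gamma> (q + u) = \<gamma> q + u *\<^sub>R d1"
    using forward[of q] by blast
  obtain d0 \<epsilon>0 where d0: "d0 \<in> {1, \<i>, -1, -\<i>}" "\<epsilon>0 > 0"
    "\<And>u. u \<in> {0..\<epsilon>0} \<Longrightarrow> \<gamma> (q - u) = \<gamma> q - u *\<^sub>R d0"
    using backward[of q] by blast
  have "d1 \<noteq> 1" using ccw_no_rightward_top_edge[OF assms(1) top d1(2)] d1(3) by blast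
  moreover have "d1 \<noteq> \<i>" using top[of "q + \<epsilon>1"] d1(2) d1(3)[of \<epsilon>1] by auto
  moreover have "d1 \<noteq> -1" using left[of "q + \<epsilon>1"] d1(2) d1(3)[of \<epsilon>1] by auto
  ultimately have d1i: "d1 = -\<i>" using d1(1) by auto
  \<comment> \<open>Arriving upwards would retrace the descent after \<open>q\<close>. The bound
    \<open>L / 4\<close> keeps the two parameters less than a lap apart.\<close>
  have "d0 \<noteq> \<i>"
  proof
    assume d0i: "d0 = \<i>"
    define u where "u = min (min \<epsilon>0 \<epsilon>1) (L / 4)"
    have u: "u > 0" "u \<le> \<epsilon>0" "u \<le> \<epsilon>1" "4 * u \<le> L" using d0 d1 L_pos by (auto simp: u_def)
    have "\<gamma> (q - u) = \<gamma> (q + u)" using d0(3)[of u] d1(3)[of u] d0i d1i u by simp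
    then have "q - u = q + u" using u by (intro inj_mod_period) auto
    then show False using u by simp
  qed
  moreover have "d0 \<noteq> -\<i>" using top[of "q - \<epsilon>0"] d0(2) d0(3)[of \<epsilon>0] by auto
  moreover have "d0 \<noteq> 1" using left[of "q - \<epsilon>0"] d0(2) d0(3)[of \<epsilon>0] by auto
  ultimately have d0i: "d0 = -1" using d0(1) by auto
  \<comment> \<open>The parameters from which the track runs straight to the left up to
    \<open>q\<close>; their infimum is the start of the edge.\<close>
  define S where "S = {v. v \<le> q \<and> (\<forall>w\<in>{v..q}. \<gamma> w = \<gamma> q + of_real (q - w))}"
  have "q - \<epsilon>0 \<in> S"
    unfolding S_def
  proof (intro CollectI conjI ballI)
    fix w assume "w \<in> {q - \<epsilon>0..q}"
    then show "\<gamma> w = \<gamma> q + of_real (q - w)"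
      using d0(3)[of "q - w"] by (simp add: d0i scaleR_conv_of_real)
  qed (use d0(2) in simp)
  \<comment> \<open>Going back a full lap returns to \<open>\<gamma> q\<close>, whereas the straight
    formula puts that point at distance \<open>L\<close> from it.\<close>
  have lowS: "q - L < v" if "v \<in> S" for v
  proof (rule ccontr)
    assume "\<not> q - L < v"
    then have "q - L \<in> {v..q}" using L_pos by simp
    then have "\<gamma> (q - L) = \<gamma> q + of_real (q - (q - L))" using that unfolding S_def by blast
    moreover have "\<gamma> (q - L) = \<gamma> q" using periodic[of "q - L"] by simp
    ultimately show False using L_pos by simp
  qed
  have bdd: "bdd_below S" using lowS by (meson bdd_belowI less_imp_le)
  define e where "e = Inf S"
  have eq: "e < q"
    using cInf_lower[OF \<open>q - \<epsilon>0 \<in> S\<close> bdd] d0(2) by (simp add: e_def)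
  have lin: "\<gamma> w = \<gamma> q + of_real (q - w)" if w: "e < w" "w \<le> q" for w
  proof -
    obtain v where "v \<in> S" "v < w"
      using cInf_lessD[of S w] w(1) \<open>q - \<epsilon>0 \<in> S\<close> unfolding e_def by auto
    moreover from this have "w \<in> {v..q}" using w(2) by simp
    ultimately show ?thesis unfolding S_def by blast
  qed
  have "\<gamma> e = \<gamma> q + of_real (q - e)"
  proof (rule tendsto_unique[of "at_right e"])
    show "(\<gamma> \<longlongrightarrow> \<gamma> e) (at_right e)"
      using continuous_track[of e] unfolding continuous_within by (rule tendsto_within_subset) simp
    have "((\<lambda>w. \<gamma> q + of_real (q - w)) \<longlongrightarrow> \<gamma> q + of_real (q - e)) (at_right e)"
      by (intro tendsto_intros)
    moreover have "eventually (\<lambda>w. \<gamma> q + of_real (q - w) = \<gamma> w) (at_right e)"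
      unfolding eventually_at_right_field by (intro exI[of _ q]) (use eq lin in \<open>metis less_imp_le\<close>)
    ultimately show "(\<gamma> \<longlongrightarrow> \<gamma> q + of_real (q - e)) (at_right e)"
      by (rule Lim_transform_eventually)
  qed simp
  then have lin': "\<gamma> w = \<gamma> q + of_real (q - w)" if "w \<in> {e..q}" for w
    using lin[of w] that by (cases "w = e") auto
  then have eS: "e \<in> S" using less_imp_le[OF eq] unfolding S_def by blast
  obtain d \<epsilon> where d: "d \<in> {1, \<i>, -1, -\<i>}" "\<epsilon> > 0"
    "\<And>u. u \<in> {0..\<epsilon>} \<Longrightarrow> \<gamma> (e - u) = \<gamma> e - u *\<^sub>R d"
    using backward[of e] by blast
  \<comment> \<open>Otherwise the straight piece would extend beyond the infimum
    \<open>e\<close>.\<close>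
  have "d \<noteq> -1"
  proof
    assume dm: "d = -1"
    have "e - \<epsilon> \<in> S"
      unfolding S_def
    proof (intro CollectI conjI ballI)
      fix w assume w: "w \<in> {e - \<epsilon>..q}"
      show "\<gamma> w = \<gamma> q + of_real (q - w)"
      proof (cases "w \<le> e")
        case True
        then have "\<gamma> w = \<gamma> e + of_real (e - w)"
          using d(3)[of "e - w"] w by (simp add: dm scaleR_conv_of_real)
        then show ?thesis using lin'[of e] eq by simp
      next
        case False
        then show ?thesis using w by (intro lin') simp
      qed
    qed (use eq d in auto)
    from cInf_lower[OF this bdd] d(2) show False by (simp add: e_def)
  qed
  moreover have "d \<noteq> 1"
  proof
    assume dp: "d = 1"
    define u where "u = min (min \<epsilon> (q - e)) (L / 4)"
    have u: "u > 0" "u \<le> \<epsilon>" "u \<le> q - e" "4 * u \<le> L" using d(2) eq L_pos by (auto simp: u_def min_def)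
    have "\<gamma> (e - u) = \<gamma> (e + u)"
      using d(3)[of u] lin'[of "e + u"] lin'[of e] dp u eq by (simp add: scaleR_conv_of_real)
    then have "e - u = e + u" using u by (intro inj_mod_period) auto
    then show False using u by simp
  qed
  moreover have "d \<noteq> -\<i>"
    using top[of "e - \<epsilon>"] d(2) d(3)[of \<epsilon>] lin'[of e] eq by auto
  ultimately have "d = \<i>" using d(1) by auto
  then show ?thesis using that[OF lowS[OF eS] eq lin' d(2)] d(3) by blast
qed

section \<open>The puppy trapped between the human and the top edge\<close>

text \<open>If no catch happens, the lifted parameters satisfy human < puppy \<le>
  \<open>e + L\<close> from the time the human is at \<open>q\<close> until it is at
  \<open>e + L\<close>, where this is absurd. \<open>init\<close> fixes the lift of the puppy to the
  lap that follows \<open>q\<close>.\<close>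

lemma caught_before_returning_to_top:
  assumes ccw: "ccw_track \<gamma> L" and tl: "top_left q" and traj: "puppy_traj \<gamma> h0 s0 (2 * L) s"
    and q: "q \<in> {h0..h0 + L}" and init: "q < s (q - h0)" "s (q - h0) < q + L"
  shows "\<exists>t\<in>{0..2 * L}. \<gamma> (s t) = \<gamma> (h0 + t)"
proof (rule ccontr)
  assume "\<not> ?thesis"
  then have free: "s t \<noteq> h0 + t" if "t \<in> {0..2 * L}" for t using that by metis
  from top_left_edge[OF ccw tl] obtain e \<epsilon> where e: "q - L < e" "e < q"
    and edge: "\<And>w. w \<in> {e..q} \<Longrightarrow> \<gamma> w = \<gamma> q + of_real (q - w)"
    and \<epsilon>: "\<epsilon> > 0" and below: "\<And>u. u \<in> {0..\<epsilon>} \<Longrightarrow> \<gamma> (e - u) = \<gamma> e - u *\<^sub>R \<i>"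
    by metis
  define E where "E = \<gamma> e"
  have Eq: "\<gamma> q = E - of_real (q - e)" using edge[of e] e by (simp add: E_def)
  \<comment> \<open>A topmost point not to the right of \<open>E\<close> lies on the edge from
    \<open>e\<close> to \<open>q\<close>, which the human does not visit at parameters strictly
    between \<open>q\<close> and \<open>e + L\<close>.\<close>
  have right: "Re (\<gamma> h) > Re E" if h: "q < h" "h < e + L" "Im (\<gamma> h) \<ge> Im E" for h
  proof (rule ccontr)
    assume *: "\<not> Re (\<gamma> h) > Re E"
    have Im: "Im (\<gamma> h) = Im (\<gamma> q)" using tl h(3) unfolding top_left_def Eq by (simp add: order_antisym)
    then have "Re (\<gamma> q) \<le> Re (\<gamma> h)" using tl unfolding top_left_def by blast
    define w where "w = q - (Re (\<gamma> h) - Re (\<gamma> q))"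
    have w: "w \<in> {e..q}" using * \<open>Re (\<gamma> q) \<le> Re (\<gamma> h)\<close> by (simp add: w_def Eq)
    have "\<gamma> h = \<gamma> w" using edge[OF w] Im by (simp add: w_def complex_eq_iff)
    then have "h = w" using h w e by (intro inj_mod_period) auto
    then show False using h w by simp
  qed
  have E': "\<gamma> (e + L) = E" by (simp add: E_def periodic)
  have top': "\<gamma> (e + L + u) = E - of_real u" if "0 \<le> u" "u \<le> q - e" for u
    using edge[of "e + u"] that periodic[of "e + u"] by (simp add: Eq algebra_simps)
  have below': "\<gamma> (e + L - u) = E - u *\<^sub>R \<i>" if "0 \<le> u" "u \<le> \<epsilon>" for u
    using below[of u] that periodic[of "e - u"] by (simp add: E_def algebra_simps)
  \<comment> \<open>A puppy resting on the top edge before its left end has no human to its left; by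
    \<open>top_bwd\<close>, resting after the right end it has none to its right. By
    \<open>climb\<close>, resting just below the corner it has no human below it.\<close>
  have top_fwd: "Re H \<ge> Re E - u" if st: "track_locmin \<gamma> H (e + L + u)" and u: "0 \<le> u" "u < q - e" for H u
  proof -
    have "0 \<le> (\<gamma> (e + L + u) - H) \<bullet> (-1)"
    proof (rule locmin_forward[OF st])
      show "q - e - u > 0" using u by simp
      show "\<gamma> (e + L + u + x) = \<gamma> (e + L + u) + x *\<^sub>R (-1)" if "x \<in> {0..q - e - u}" for x
      proof -
        have "\<gamma> (e + L + u + x) = E - of_real (u + x)"
          using top'[of "u + x"] that u by (simp add: add.assoc)
        moreover have "\<gamma> (e + L + u) = E - of_real u" using top'[of u] u by simp
        ultimately show ?thesis by (simp add: scaleR_conv_of_real)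
      qed
    qed
    then show ?thesis using top'[of u] u by (simp add: inner_complex_def)
  qed
  have top_bwd: "Re H \<le> Re E - u" if st: "track_locmin \<gamma> H (e + L + u)" and u: "0 < u" "u \<le> q - e" for H u
  proof -
    have "(\<gamma> (e + L + u) - H) \<bullet> (-1) \<le> 0"
    proof (rule locmin_backward[OF st])
      show "u > 0" using u by simp
      show "\<gamma> (e + L + u - x) = \<gamma> (e + L + u) - x *\<^sub>R (-1)" if "x \<in> {0..u}" for x
      proof -
        have "\<gamma> (e + L + u - x) = E - of_real (u - x)"
          using top'[of "u - x"] that u by (simp add: add_diff_eq)
        moreover have "\<gamma> (e + L + u) = E - of_real u" using top'[of u] u by simp
        ultimately show ?thesis by (simp add: scaleR_conv_of_real)
      qed
    qed
    then show ?thesis using top'[of u] u by (simp add: inner_complex_def)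
  qed
  have climb: "Im H \<ge> Im E - u" if st: "track_locmin \<gamma> H (e + L - u)" and u: "0 \<le> u" "u < \<epsilon>" for H u
  proof -
    have "(\<gamma> (e + L - u) - H) \<bullet> \<i> \<le> 0"
    proof (rule locmin_backward[OF st])
      show "\<epsilon> - u > 0" using u by simp
      show "\<gamma> (e + L - u - x) = \<gamma> (e + L - u) - x *\<^sub>R \<i>" if "x \<in> {0..\<epsilon> - u}" for x
      proof -
        have "\<gamma> (e + L - u - x) = E - (u + x) *\<^sub>R \<i>"
          using below'[of "u + x"] that u by (simp add: diff_diff_eq)
        moreover have "\<gamma> (e + L - u) = E - u *\<^sub>R \<i>" using below'[of u] u by simp
        ultimately show ?thesis by (simp add: scaleR_left_distrib)
      qed
    qed
    then show ?thesis using below'[of u] u by (simp add: inner_complex_def)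
  qed
  \<comment> \<open>As \<open>e < q\<close> and \<open>q \<le> h0 + L\<close>, the return to
    \<open>e\<close> takes place before time \<open>2 * L\<close>.\<close>
  have range: "t \<in> {0..2 * L}" if "q - h0 \<le> t" "t \<le> e + L - h0" for t
    using that q e by auto
  have stable: "track_locmin \<gamma> (\<gamma> (h0 + t)) (s t)" if "q - h0 \<le> t" "t \<le> e + L - h0" for t
    using traj range[OF that] unfolding puppy_traj_def by blast
  have cont_human: "((\<lambda>y. \<gamma> (h0 + y)) \<longlongrightarrow> \<gamma> (h0 + x)) (at x within A)" for x A
  proof -
    have "continuous_on UNIV (\<lambda>y. \<gamma> (h0 + y))"
      by (rule continuous_on_compose2[OF continuous_on_track[of UNIV]]) (auto intro: continuous_intros)
    then have "((\<lambda>y. \<gamma> (h0 + y)) \<longlongrightarrow> \<gamma> (h0 + x)) (at x)"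
      by (simp add: continuous_on_def)
    then show ?thesis by (rule tendsto_within_subset) simp
  qed
  define P where "P t \<longleftrightarrow> h0 + t < s t \<and> s t \<le> e + L" for t
  have "P (e + L - h0)"
  proof (rule real_interval_induct[where P = P and a = "q - h0" and b = "e + L - h0"])
    \<comment> \<open>With the human at the left end of the edge, no position of the edge from
      \<open>e + L\<close> up to, but excluding, \<open>q + L\<close> is a resting place.\<close>
    have "s (q - h0) < e + L"
    proof (rule ccontr)
      assume "\<not> ?thesis"
      then show False
        using top_fwd[of "\<gamma> q" "s (q - h0) - (e + L)"] stable[of "q - h0"] init e by (simp add: Eq)
    qed
    then show "P (q - h0)" using init by (simp add: P_def)
  next
    fix x assume x: "q - h0 < x" "x \<le> e + L - h0" and IH: "\<And>y. q - h0 \<le> y \<Longrightarrow> y < x \<Longrightarrow> P y"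
    define H where "H = \<gamma> (h0 + x)"
    have xr: "x \<in> {0<..2 * L}" using range[of x] x q by auto
    from traj xr obtain a where lim: "(s \<longlongrightarrow> a) (at_left x)"
      and a: "if track_locmin \<gamma> H a then s x = a else puppy_run \<gamma> H a (s x)"
      unfolding puppy_traj_def H_def by blast
    have nx: "s x \<noteq> h0 + x" using free[of x] xr by auto
    have ev: "eventually (\<lambda>y. P y \<and> q - h0 \<le> y \<and> y < x) (at_left x)"
      unfolding eventually_at_left_field using IH x by (intro exI[of _ "q - h0"]) auto
    have "a \<le> e + L"
      by (rule tendsto_upperbound[OF lim]) (use ev in \<open>auto simp: P_def elim: eventually_mono\<close>)
    have "h0 + x \<le> a"
    proof (rule tendsto_le[OF _ lim])
      show "((\<lambda>y. h0 + y) \<longlongrightarrow> h0 + x) (at_left x)" by (intro tendsto_intros)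
      show "\<forall>\<^sub>F y in at_left x. h0 + y \<le> s y" using ev by (rule eventually_mono) (simp add: P_def)
    qed simp
    show "P x"
    proof (cases "track_locmin \<gamma> H a")
      case True
      then show ?thesis using a nx \<open>a \<le> e + L\<close> \<open>h0 + x \<le> a\<close> by (auto simp: P_def)
    next
      case False
      then have run: "puppy_run \<gamma> H a (s x)" using a by simp
      then consider
          (fwd) "a < s x" "\<And>u v. a \<le> u \<Longrightarrow> u < v \<Longrightarrow> v \<le> s x \<Longrightarrow> cmod (\<gamma> v - H) < cmod (\<gamma> u - H)"
        | (bwd) "s x < a" "\<And>u v. s x \<le> u \<Longrightarrow> u < v \<Longrightarrow> v \<le> a \<Longrightarrow> cmod (\<gamma> u - H) < cmod (\<gamma> v - H)"
        unfolding puppy_run_def by blast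
      then show ?thesis
      proof cases
        case bwd
        \<comment> \<open>A run cannot pass the human, where the distance is already 0.\<close>
        have "\<not> s x < h0 + x"
          using bwd(2)[of "s x" "h0 + x"] \<open>h0 + x \<le> a\<close> by (auto simp: H_def)
        then show ?thesis using bwd(1) nx \<open>a \<le> e + L\<close> by (auto simp: P_def)
      next
        case fwd
        have "s x \<le> e + L"
        proof (rule ccontr)
          assume over: "\<not> s x \<le> e + L"
          then have "h0 + x \<noteq> e + L"
            using fwd(2)[of "e + L" "s x"] \<open>a \<le> e + L\<close> by (auto simp: H_def)
          then have hx: "q < h0 + x" "h0 + x < e + L" using x by auto
          \<comment> \<open>The run covers the first \<open>w\<close> units of the top edge; coming
            closer there means that the human is to the left of \<open>E\<close>.\<close>
          define w where "w = min (q - e) (s x - (e + L))"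
          have w: "w > 0" "w \<le> q - e" "e + L + w \<le> s x" using over e by (auto simp: w_def)
          have "(E - H) \<bullet> (-1) < 0"
          proof (rule inner_neg_if_norm_less[OF w(1)])
            show "norm (E - H + w *\<^sub>R (-1)) < norm (E - H)"
            proof -
              have "norm (E - of_real w - H) < norm (E - H)"
                using fwd(2)[of "e + L" "e + L + w"] w \<open>a \<le> e + L\<close> top'[of w] E' by simp
              moreover have "E - H + w *\<^sub>R (-1) = E - of_real w - H"
                by (simp add: scaleR_conv_of_real)
              ultimately show ?thesis by (simp only:)
            qed
          qed
          then have "Re H < Re E" by (simp add: inner_complex_def)
          moreover have "Im H \<ge> Im E"
          \<comment> \<open>If the run starts below the corner, its final climb towards
            \<open>E\<close> shows the human to be at top height. If it starts at the corner, this
            follows by passing to the limit in \<open>climb\<close> along the resting positions at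
            earlier times.\<close>
          proof (cases "a < e + L")
            case True
            have "0 \<le> (E - H) \<bullet> (-\<i>)"
            proof (rule inner_nonneg_if_norm_le)
              show "min \<epsilon> (e + L - a) > 0" using \<epsilon> True by simp
              fix u assume u: "0 < u" "u < min \<epsilon> (e + L - a)"
              then have "norm (E - H) < norm (E - u *\<^sub>R \<i> - H)"
                using fwd(2)[of "e + L - u" "e + L"] over below'[of u] E' by simp
              moreover have "E - H + u *\<^sub>R (-\<i>) = E - u *\<^sub>R \<i> - H" by simp
              ultimately show "norm (E - H) \<le> norm (E - H + u *\<^sub>R (-\<i>))" by (simp only: less_imp_le)
            qed
            then show ?thesis by (simp add: inner_complex_def)
          next
            case False
            then have ae: "a = e + L" using \<open>a \<le> e + L\<close> by simp
            have "Im E - (e + L - a) \<le> Im H"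
            proof (rule tendsto_le[of "at_left x"])
              show "((\<lambda>y. Im (\<gamma> (h0 + y))) \<longlongrightarrow> Im H) (at_left x)"
                unfolding H_def by (intro tendsto_intros cont_human)
              show "((\<lambda>y. Im E - (e + L - s y)) \<longlongrightarrow> Im E - (e + L - a)) (at_left x)"
                by (intro tendsto_intros lim)
              have "\<forall>\<^sub>F y in at_left x. s y > e + L - \<epsilon>"
                using order_tendstoD(1)[OF lim, of "e + L - \<epsilon>"] ae \<epsilon> by simp
              with ev show "\<forall>\<^sub>F y in at_left x. Im E - (e + L - s y) \<le> Im (\<gamma> (h0 + y))"
              proof eventually_elim
                case (elim y)
                then show ?case
                  using climb[of "\<gamma> (h0 + y)" "e + L - s y"] stable[of y] x by (simp add: P_def)
              qed
            qed simp
            then show ?thesis using ae by simp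
          qed
          ultimately show False using right[OF hx] by (simp add: H_def)
        qed
        then show ?thesis using fwd(1) \<open>h0 + x \<le> a\<close> by (auto simp: P_def)
      qed
    qed
  next
    fix x assume x: "q - h0 \<le> x" "x < e + L - h0" and Px: "P x"
    have "x \<in> {0..<2 * L}" using range[of x] x q e by auto
    then have lim: "(s \<longlongrightarrow> s x) (at_right x)"
      using traj unfolding puppy_traj_def continuous_within by blast
    have ahead: "\<forall>\<^sub>F y in at_right x. h0 + y < s y"
    proof -
      have "((\<lambda>y. s y - (h0 + y)) \<longlongrightarrow> s x - (h0 + x)) (at_right x)"
        by (intro tendsto_intros lim)
      then have "\<forall>\<^sub>F y in at_right x. 0 < s y - (h0 + y)"
        using Px by (intro order_tendstoD(1)) (auto simp: P_def)
      then show ?thesis by (rule eventually_mono) simp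
    qed
    have "\<forall>\<^sub>F y in at_right x. s y \<le> e + L"
    proof (cases "s x < e + L")
      case True
      from order_tendstoD(2)[OF lim this] show ?thesis by (rule eventually_mono) simp
    next
      \<comment> \<open>Resting at the corner forces the human to be at top height and, by
        \<open>right\<close>, strictly to the right of \<open>E\<close>. This persists for a short
        time, during which \<open>top_bwd\<close> excludes any resting place just past the
        corner.\<close>
      case False
      then have sx: "s x = e + L" using Px by (simp add: P_def)
      have st: "track_locmin \<gamma> (\<gamma> (h0 + x)) (e + L)" using stable[of x] x sx by simp
      have "Re (\<gamma> (h0 + x)) \<ge> Re E" using top_fwd[of _ 0] st e by simp
      then have "h0 + x \<noteq> q" using e Eq by fastforce
      moreover have "Im (\<gamma> (h0 + x)) \<ge> Im E" using climb[of _ 0] st \<epsilon> by simp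
      ultimately have "Re (\<gamma> (h0 + x)) > Re E" using right[of "h0 + x"] x by simp
      then have "\<forall>\<^sub>F y in at_right x. Re (\<gamma> (h0 + y)) > Re E"
        by (intro order_tendstoD(1)[OF tendsto_Re[OF cont_human]])
      moreover have "\<forall>\<^sub>F y in at_right x. s y < q + L"
        using order_tendstoD(2)[OF lim, of "q + L"] sx e by simp
      moreover have "\<forall>\<^sub>F y in at_right x. x < y \<and> y < e + L - h0"
        unfolding eventually_at_right_field using x by blast
      ultimately show ?thesis
      proof eventually_elim
        case (elim y)
        show ?case
        proof (rule ccontr)
          assume "\<not> s y \<le> e + L"
          then show False
            using top_bwd[of "\<gamma> (h0 + y)" "s y - (e + L)"] stable[of y] elim x by simp
        qed
      qed
    qed
    with ahead show "eventually P (at_right x)"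
      by eventually_elim (simp add: P_def)
  qed (use e in auto)
  then show False by (auto simp: P_def)
qed

end

section \<open>Arbitrary initial configurations\<close>

theorem theorem2:
  fixes \<gamma> :: "real \<Rightarrow> complex" and L h0 s0 :: real and s :: "real \<Rightarrow> real"
  assumes "orth_polygon_track \<gamma> L"
    and "ccw_track \<gamma> L"
    and "puppy_traj \<gamma> h0 s0 (2 * L) s"
  shows "\<exists>t\<in>{0..2 * L}. \<gamma> (s t) = \<gamma> (h0 + t)"
proof (rule ccontr)
  assume free: "\<not> ?thesis"
  interpret orth_track \<gamma> L by (rule orth_track_if_orth_polygon_track) fact
  obtain q where q: "q \<in> {h0..h0 + L}" "top_left q" using ex_top_left by blast
  \<comment> \<open>The puppy's parameter may be several laps away from the human's. Shifting the
    human by \<open>m\<close> laps changes no position and puts the puppy in the lap after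
    \<open>q\<close>; the lower bound is strict because equality would be a catch.\<close>
  obtain m :: int where m: "0 \<le> (s (q - h0) - q) - of_int m * L" "(s (q - h0) - q) - of_int m * L < L"
    using periodic_reduce[OF L_pos] by blast
  have shift: "\<gamma> (h0 + of_int m * L + t) = \<gamma> (h0 + t)" for t
    using periodic_int[of "h0 + t" m] by (simp add: algebra_simps)
  have "\<gamma> (s (q - h0)) \<noteq> \<gamma> q" using free q by (auto dest!: bspec[of _ _ "q - h0"])
  then have "s (q - h0) \<noteq> q + of_int m * L" using periodic_int[of q m] by metis
  then have init: "q + of_int m * L < s (q - h0)" "s (q - h0) < q + of_int m * L + L"
    using m by auto
  have "top_left (q + of_int m * L)" using q(2) by (simp add: top_left_def periodic_int)
  moreover have "puppy_traj \<gamma> (h0 + of_int m * L) s0 (2 * L) s"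
    using assms(3) by (simp only: puppy_traj_def shift periodic_int)
  ultimately have "\<exists>t\<in>{0..2 * L}. \<gamma> (s t) = \<gamma> (h0 + of_int m * L + t)"
    using init q(1) by (intro caught_before_returning_to_top[OF assms(2)]) auto
  then show False using free by (simp add: shift)
qed

end
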